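(* Let $\nu$ be a probability measure on $\mathbb R^n$ fulfilling approximate tensorization of entropy with constant $\kappa\ge1$, and let $X\sim\nu$. Then the random vector $\operatorname{sign}(X)\in\{\pm1\}^n$ is $\kappa$-sub-Gaussian, i.e. $$\mathbb E\left[\exp\left(u^\top\operatorname{sign}(X)-\mathbb E[u^\top\operatorname{sign}(X)]\right)\right]\le\exp\left(\frac{\kappa\|u\|_2^2}{2}\right)\quad\text{for all }u\in\mathbb R^n.$$
   Context: $\operatorname{sign}$ is applied entrywise and takes values in $\{-1,1\}$ (with a fixed value in $\{-1,1\}$ at $0$). A random vector $Y\in\mathbb R^n$ is $\sigma^2$-sub-Gaussian if $\mathbb E[\exp(u^\top Y-\mathbb E[u^\top Y])]\le\exp(\sigma^2\|u\|_2^2/2)$ for all $u\in\mathbb R^n$. For a probability measure $\nu$ and $f\ge0$ with $f$ and $f|\log f|$ $\nu$-integrable, $\operatorname{Ent}_\nu(f):=\int f\log f\,d\nu-\left(\int f\,d\nu\right)\log\left(\int f\,d\nu\right)$. A probability measure $\nu$ on $\mathbb R^n$ fulfills approximate tensorization of entropy (ATE) with constant $\kappa\ge1$ if for all $f:\mathbb R^n\to[0,\infty)$ for which the quantities involved exist, with $X\sim\nu$, $$\operatorname{Ent}_\nu(f)\le\kappa\sum_{i=1}^n\mathbb E\left[\operatorname{Ent}_{\nu(\cdot\mid X_{-i})}(f)\right],$$ where $X_{-i}$ denotes all entries of $X$ except the $i$-th, $\nu(\cdot\mid X_{-i})$ is the conditional law of the $i$-th coordinate given the others, and in the $i$-th term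 $f$ is regarded as a function of the $i$-th coordinate with the others fixed to $X_{-i}$. *)

theory Defs
  imports "HOL-Probability.Probability"
begin

text \<open>\<open>s\<close> is the fixed value of the sign function at \<open>0\<close>; it is meant to be \<open>1\<close> or \<open>-1\<close>.\<close>

definition sign_vec :: "real \<Rightarrow> real ^ 'n \<Rightarrow> real ^ 'n" where
  "sign_vec s x = (\<chi> i. if x $ i = 0 then s else sgn (x $ i))"

text \<open>The integrability conditions are explicit because the Bochner integral of a non-integrable
  function is \<open>0\<close>, which would make the inequality true for the wrong reason. The parameter \<open>v\<close> is
  the variance proxy \<open>\<sigma>\<^sup>2\<close>, not \<open>\<sigma>\<close>.\<close>

definition sub_Gaussian :: "'a measure \<Rightarrow> real \<Rightarrow> ('a \<Rightarrow> real ^ 'n) \<Rightarrow> bool" where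
  "sub_Gaussian M v Y \<longleftrightarrow>
     Y \<in> borel_measurable M \<and>
     (\<forall>u :: real ^ 'n.
        integrable M (\<lambda>\<omega>. u \<bullet> Y \<omega>) \<and>
        integrable M (\<lambda>\<omega>. exp (u \<bullet> Y \<omega> - (\<integral>\<omega>'. u \<bullet> Y \<omega>' \<partial>M))) \<and>
        (\<integral>\<omega>. exp (u \<bullet> Y \<omega> - (\<integral>\<omega>'. u \<bullet> Y \<omega>' \<partial>M)) \<partial>M) \<le> exp (v * (norm u)\<^sup>2 / 2))"

text \<open>The library's \<open>ln 0 = 0\<close> agrees with the convention \<open>0 log 0 = 0\<close>.\<close>

definition Ent_defined :: "'a measure \<Rightarrow> ('a \<Rightarrow> real) \<Rightarrow> bool" where
  "Ent_defined \<mu> f \<longleftrightarrow>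
     (\<forall>x. 0 \<le> f x) \<and> integrable \<mu> f \<and> integrable \<mu> (\<lambda>x. f x * \<bar>ln (f x)\<bar>)"

definition Ent :: "'a measure \<Rightarrow> ('a \<Rightarrow> real) \<Rightarrow> real" where
  "Ent \<mu> f = (\<integral>x. f x * ln (f x) \<partial>\<mu>) - (\<integral>x. f x \<partial>\<mu>) * ln (\<integral>x. f x \<partial>\<mu>)"

definition others :: "'n \<Rightarrow> real ^ 'n \<Rightarrow> 'n \<Rightarrow> real" where
  "others i x = (\<lambda>j\<in>- {i}. x $ j)"

abbreviation others_space :: "'n \<Rightarrow> ('n \<Rightarrow> real) measure" where
  "others_space i \<equiv> PiM (- {i}) (\<lambda>_. borel)"

text \<open>\<open>K\<close> is a regular conditional distribution of the \<open>i\<close>-th coordinate given all other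
  coordinates under \<open>\<nu>\<close>: a probability kernel such that \<open>K (others i x) B\<close> is, for every Borel
  set \<open>B\<close>, a version of the conditional probability of \<open>x $ i \<in> B\<close> given \<open>\<sigma>(others i)\<close>.\<close>

definition cond_law :: "(real ^ 'n) measure \<Rightarrow> 'n \<Rightarrow> (('n \<Rightarrow> real) \<Rightarrow> real measure) \<Rightarrow> bool" where
  "cond_law \<nu> i K \<longleftrightarrow>
     K \<in> others_space i \<rightarrow>\<^sub>M prob_algebra borel \<and>
     (\<forall>B \<in> sets borel. AE x in \<nu>.
        measure (K (others i x)) B =
        real_cond_exp \<nu> (vimage_algebra (space \<nu>) (others i) (others_space i))
          (\<lambda>x. indicator B (x $ i)) x)"

text \<open>\<open>slice f i y\<close> is \<open>f\<close> as a function of the \<open>i\<close>-th coordinate, the others being fixed to \<open>y\<close>.\<close>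

definition slice :: "(real ^ 'n \<Rightarrow> real) \<Rightarrow> 'n \<Rightarrow> ('n \<Rightarrow> real) \<Rightarrow> real \<Rightarrow> real" where
  "slice f i y t = f (vec_lambda (y(i := t)))"

text \<open>Regular conditional distributions on \<open>\<real>\<close> exist and are unique \<open>\<nu>\<close>-almost everywhere, so
  the choice of the kernels \<open>K\<close> is immaterial. The three conditions on \<open>f\<close> say that the entropies
  and expectations in the inequality exist.\<close>

definition ATE :: "(real ^ 'n) measure \<Rightarrow> real \<Rightarrow> bool" where
  "ATE \<nu> \<kappa> \<longleftrightarrow>
     (\<exists>K. (\<forall>i. cond_law \<nu> i (K i)) \<and>
       (\<forall>f \<in> borel_measurable borel.
          Ent_defined \<nu> f \<longrightarrow>
          (\<forall>i. AE x in \<nu>. Ent_defined (K i (others i x)) (slice f i (others i x))) \<longrightarrow>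
          (\<forall>i. integrable \<nu> (\<lambda>x. Ent (K i (others i x)) (slice f i (others i x)))) \<longrightarrow>
          Ent \<nu> f \<le> \<kappa> * (\<Sum>i\<in>UNIV. \<integral>x. Ent (K i (others i x)) (slice f i (others i x)) \<partial>\<nu>)))"

end

theory Submission
  imports Defs
begin

text \<open>
  The proof is the entropy method. Put \<open>g x = u \<bullet> sign_vec s x\<close>. When all coordinates but the
  \<open>i\<close>-th are fixed, \<open>exp g\<close> is a constant times \<open>exp (u\<^sub>i \<tau>)\<close> for a sign \<open>\<tau>\<close>, and the entropy of
  such a function is at most \<open>u\<^sub>i\<^sup>2 / 2\<close> times its mean, whatever the law of the sign
  (\<open>two_point_log_Sobolev\<close>). Averaging over the other coordinates, where the tower property turns
  the conditional means back into \<open>E exp g\<close>, and summing over \<open>i\<close>, approximate tensorization gives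
  \<open>Ent (exp g) \<le> \<kappa> |u|\<^sup>2 / 2 * E exp g\<close> (\<open>ATE_entropy_exp_sign\<close>).

  Applied to \<open>t u\<close> in place of \<open>u\<close>, this is a differential inequality for the moment generating
  function \<open>F t = E exp (t g)\<close>, because \<open>Ent (exp (t g)) = t F' t - F t ln (F t)\<close>. The Herbst
  argument (\<open>Herbst\<close>) integrates it from \<open>0\<close> to \<open>1\<close> to the sub-Gaussian bound.

  Since \<open>g\<close> takes finitely many values, every expectation of a function of \<open>g\<close> is a finite sum; this
  takes care of integrability and of differentiation under the integral sign.
\<close>

section \<open>Functions with finitely many values\<close>

lemma (in prob_space) integral_comp_finite_range:
  fixes g \<psi> :: "_ \<Rightarrow> real"
  assumes [measurable]: "g \<in> borel_measurable M" and V: "finite V" "\<And>x. g x \<in> V"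
  shows "integrable M (\<lambda>x. \<psi> (g x))"
    and "(\<integral>x. \<psi> (g x) \<partial>M) = (\<Sum>v\<in>V. prob {x \<in> space M. g x = v} * \<psi> v)"
proof -
  have eq: "\<psi> (g x) = (\<Sum>v\<in>V. indicator {x \<in> space M. g x = v} x * \<psi> v)" if "x \<in> space M" for x
  proof -
    have "(\<Sum>v\<in>V. indicator {x \<in> space M. g x = v} x * \<psi> v) = (\<Sum>v\<in>V. if v = g x then \<psi> v else 0)"
      using that by (intro sum.cong) (auto simp: indicator_def)
    then show ?thesis using V by simp
  qed
  have int: "integrable M (\<lambda>x. indicator {x \<in> space M. g x = v} x * \<psi> v)" for v
    by (intro integrable_mult_left) (auto simp: integrable_indicator_iff emeasure_eq_measure)
  show "integrable M (\<lambda>x. \<psi> (g x))"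
    by (subst Bochner_Integration.integrable_cong[OF refl eq]) (auto intro: int)
  have "(\<integral>x. \<psi> (g x) \<partial>M) = (\<integral>x. (\<Sum>v\<in>V. indicator {x \<in> space M. g x = v} x * \<psi> v) \<partial>M)"
    by (intro Bochner_Integration.integral_cong refl eq)
  also have "\<dots> = (\<Sum>v\<in>V. prob {x \<in> space M. g x = v} * \<psi> v)"
    by (subst Bochner_Integration.integral_sum[OF int]) (auto intro!: sum.cong)
  finally show "(\<integral>x. \<psi> (g x) \<partial>M) = (\<Sum>v\<in>V. prob {x \<in> space M. g x = v} * \<psi> v)" .
qed

section \<open>Entropy of a two-valued exponential\<close>

lemma two_point_exp_pos:
  fixes a q :: real
  assumes "0 \<le> q" "q \<le> 1"
  shows "0 < q * exp a + (1 - q) * exp (-a)"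
proof (cases "q = 0")
  case False
  then show ?thesis using assms
    by (intro add_pos_nonneg mult_pos_pos mult_nonneg_nonneg) auto
qed simp

lemma two_point_exp_le:
  fixes a q :: real
  assumes "0 \<le> q" "q \<le> 1"
  shows "q * exp a + (1 - q) * exp (-a) \<le> exp \<bar>a\<bar>"
proof -
  have "q * exp a + (1 - q) * exp (-a) \<le> q * exp \<bar>a\<bar> + (1 - q) * exp \<bar>a\<bar>"
    using assms by (intro add_mono mult_left_mono) auto
  then show ?thesis by (simp add: algebra_simps)
qed

lemma two_point_exp_ge:
  fixes a q :: real
  assumes "0 \<le> q" "q \<le> 1"
  shows "exp (- \<bar>a\<bar>) \<le> q * exp a + (1 - q) * exp (-a)"
proof -
  have "q * exp (- \<bar>a\<bar>) + (1 - q) * exp (- \<bar>a\<bar>) \<le> q * exp a + (1 - q) * exp (-a)"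
    using assms by (intro add_mono mult_left_mono) auto
  then show ?thesis by (simp add: algebra_simps)
qed

text \<open>
  Write \<open>\<Lambda> = ln m\<close> for the cumulant generating function of a variable with values \<open>\<plusminus>1\<close>, so that
  \<open>\<Lambda>' = d / m\<close>. After division by \<open>m a\<close> the claim reads \<open>a \<Lambda>' a - \<Lambda> a \<le> a\<^sup>2 / 2\<close>. The
  difference of the two sides vanishes at \<open>0\<close> and has derivative \<open>a (1 - \<Lambda>'' a)\<close>, and
  \<open>\<Lambda>'' = 1 - (d / m)\<^sup>2 \<le> 1\<close> because \<open>m'' = m\<close>: it is the variance of a variable with values \<open>\<plusminus>1\<close>.
\<close>

lemma two_point_log_Sobolev_nonneg:
  fixes a q :: real
  assumes q: "0 \<le> q" "q \<le> 1" and a: "0 \<le> a"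
  defines "m \<equiv> \<lambda>t. q * exp t + (1 - q) * exp (-t)"
    and "d \<equiv> \<lambda>t. q * exp t - (1 - q) * exp (-t)"
  shows "a * d a - m a * ln (m a) \<le> a\<^sup>2 / 2 * m a"
proof -
  have m: "0 < m t" for t
    using two_point_exp_pos[OF q] by (simp add: m_def)
  have dm: "(m has_real_derivative d t) (at t)" and dd: "(d has_real_derivative m t) (at t)" for t
    unfolding m_def d_def by (auto intro!: derivative_eq_intros)
  define D where "D = (\<lambda>t. t\<^sup>2 / 2 - (t * (d t / m t) - ln (m t)))"
  have dD: "(D has_real_derivative t * (d t / m t)\<^sup>2) (at t)" for t
  proof -
    have "(D has_real_derivative
        t - (1 * (d t / m t) + (m t * m t - d t * d t) / (m t * m t) * t - d t / m t)) (at t)"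
      unfolding D_def using m[of t]
      by (intro DERIV_diff DERIV_mult DERIV_ident DERIV_divide dm dd)
        (auto intro!: derivative_eq_intros dm)
    moreover have "(m t * m t - d t * d t) / (m t * m t) = 1 - (d t / m t)\<^sup>2"
      using m[of t] by (simp add: diff_divide_distrib power2_eq_square)
    then have "t - (1 * (d t / m t) + (m t * m t - d t * d t) / (m t * m t) * t - d t / m t)
        = t * (d t / m t)\<^sup>2"
      by (simp only:) (simp add: right_diff_distrib mult.commute)
    ultimately show ?thesis by (rule DERIV_cong)
  qed
  have "D 0 \<le> D a"
  proof (rule DERIV_nonneg_imp_nondecreasing[of 0 a D])
    show "\<exists>y. (D has_real_derivative y) (at t) \<and> 0 \<le> y" if "0 \<le> t" for t
      using dD[of t] that by (meson mult_nonneg_nonneg zero_le_power2)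
  qed (rule a)
  then have "a * (d a / m a) - ln (m a) \<le> a\<^sup>2 / 2"
    by (simp add: D_def m_def)
  then have "(a * (d a / m a) - ln (m a)) * m a \<le> a\<^sup>2 / 2 * m a"
    using m[of a] by (intro mult_right_mono) auto
  moreover have "(a * (d a / m a) - ln (m a)) * m a = a * d a - m a * ln (m a)"
    using m[of a] by (simp add: left_diff_distrib)
  ultimately show ?thesis by (simp only:)
qed

text \<open>For negative \<open>a\<close>, exchange the roles of the two points.\<close>

lemma two_point_log_Sobolev:
  fixes a q :: real
  assumes q: "0 \<le> q" "q \<le> 1"
  defines "m \<equiv> q * exp a + (1 - q) * exp (-a)"
  shows "a * (q * exp a - (1 - q) * exp (-a)) - m * ln m \<le> a\<^sup>2 / 2 * m"
proof (cases "0 \<le> a")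
  case True
  then show ?thesis using two_point_log_Sobolev_nonneg[OF q] by (simp add: m_def)
next
  case False
  then show ?thesis using two_point_log_Sobolev_nonneg[of "1 - q" "- a"] q
    by (simp add: m_def algebra_simps)
qed

lemma (in prob_space) integral_comp_pm_one:
  fixes \<tau> \<psi> :: "_ \<Rightarrow> real"
  assumes \<tau>: "\<tau> \<in> borel_measurable M" "\<And>x. \<tau> x \<in> {-1, 1}"
  defines "q \<equiv> prob {x \<in> space M. \<tau> x = 1}"
  shows "integrable M (\<lambda>x. \<psi> (\<tau> x))"
    and "(\<integral>x. \<psi> (\<tau> x) \<partial>M) = q * \<psi> 1 + (1 - q) * \<psi> (-1)"
proof -
  have [measurable]: "\<tau> \<in> borel_measurable M" by fact
  note int = integral_comp_finite_range[of \<tau> "{-1, 1}", OF \<tau>(1) _ \<tau>(2)]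
  show "integrable M (\<lambda>x. \<psi> (\<tau> x))"
    by (rule int) simp
  have "{x \<in> space M. \<tau> x = -1} = space M - {x \<in> space M. \<tau> x = 1}"
    using \<tau>(2) by force
  then have "prob {x \<in> space M. \<tau> x = -1} = 1 - q"
    by (simp add: q_def prob_compl)
  then show "(\<integral>x. \<psi> (\<tau> x) \<partial>M) = q * \<psi> 1 + (1 - q) * \<psi> (-1)"
    by (subst int) (simp_all add: q_def)
qed

text \<open>
  With \<open>m\<close> the mean of \<open>exp (a * \<tau>)\<close>, the entropy is the left-hand side of the two-point inequality;
  the factor \<open>c\<close> comes out because entropy is homogeneous.
\<close>

lemma (in prob_space) Ent_exp_pm_one:
  fixes \<tau> :: "_ \<Rightarrow> real" and a c :: real
  assumes \<tau>: "\<tau> \<in> borel_measurable M" "\<And>x. \<tau> x \<in> {-1, 1}" and c: "0 < c"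
  defines "q \<equiv> prob {x \<in> space M. \<tau> x = 1}"
  defines "m \<equiv> q * exp a + (1 - q) * exp (-a)"
  shows "Ent_defined M (\<lambda>x. c * exp (a * \<tau> x))"
    and "Ent M (\<lambda>x. c * exp (a * \<tau> x)) = c * (a * (q * exp a - (1 - q) * exp (-a)) - m * ln m)"
proof -
  note int = integral_comp_pm_one[OF \<tau>, folded q_def]
  show "Ent_defined M (\<lambda>x. c * exp (a * \<tau> x))"
    unfolding Ent_defined_def using c
      int(1)[of "\<lambda>t. c * exp (a * t)"] int(1)[of "\<lambda>t. c * exp (a * t) * \<bar>ln (c * exp (a * t))\<bar>"]
    by simp
  have m: "0 < m" unfolding m_def by (rule two_point_exp_pos) (simp_all add: q_def)
  have mean: "(\<integral>x. c * exp (a * \<tau> x) \<partial>M) = c * m"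
    unfolding int(2)[of "\<lambda>t. c * exp (a * t)"] by (simp add: m_def algebra_simps)
  have "(\<integral>x. c * exp (a * \<tau> x) * ln (c * exp (a * \<tau> x)) \<partial>M)
      = q * (c * exp a * (ln c + a)) + (1 - q) * (c * exp (-a) * (ln c - a))"
    unfolding int(2)[of "\<lambda>t. c * exp (a * t) * ln (c * exp (a * t))"]
    using c by (simp add: ln_mult)
  also have "\<dots> = c * (m * ln c + a * (q * exp a - (1 - q) * exp (-a)))"
    unfolding m_def by (simp add: algebra_simps)
  finally show "Ent M (\<lambda>x. c * exp (a * \<tau> x)) = c * (a * (q * exp a - (1 - q) * exp (-a)) - m * ln m)"
    unfolding Ent_def mean using c m by (simp add: ln_mult) (simp add: algebra_simps)
qed

section \<open>The Herbst argument\<close>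

text \<open>
  The hypothesis says that \<open>ln (F t) / t - c t\<close> has a nonpositive derivative for \<open>t > 0\<close>, since
  \<open>(ln (F t) / t)' = (t F' t - F t ln (F t)) / (t\<^sup>2 F t)\<close>. Its value at \<open>1\<close> is therefore bounded by
  its limit at \<open>0\<close>, which is \<open>(ln F)' 0 = F' 0\<close> because \<open>F 0 = 1\<close>.
\<close>

lemma Herbst:
  fixes F F' :: "real \<Rightarrow> real"
  assumes F: "\<And>t. (F has_real_derivative F' t) (at t)" and pos: "\<And>t. 0 < F t" and "F 0 = 1"
    and ent: "\<And>t. t * F' t - F t * ln (F t) \<le> c * t\<^sup>2 * F t"
  shows "F 1 \<le> exp (F' 0 + c)"
proof -
  define H where "H = (\<lambda>t. ln (F t) / t - c * t)"
  have dlog: "((\<lambda>t. ln (F t)) has_real_derivative F' t / F t) (at t)" for t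
    using pos[of t] by (auto intro!: derivative_eq_intros intro: F)
  have dH: "(H has_real_derivative ((t * F' t - F t * ln (F t)) / (t\<^sup>2 * F t) - c)) (at t)"
    if "0 < t" for t
  proof -
    have "(H has_real_derivative (F' t / F t * t - ln (F t) * 1) / (t * t) - c * 1) (at t)"
      unfolding H_def using that
      by (intro DERIV_diff DERIV_cmult DERIV_divide DERIV_ident dlog) auto
    moreover have "(F' t / F t * t - ln (F t) * 1) / (t * t) - c * 1
        = (t * F' t - F t * ln (F t)) / (t\<^sup>2 * F t) - c"
      using pos[of t] that by (simp add: divide_simps power2_eq_square)
    ultimately show ?thesis by (rule DERIV_cong)
  qed
  have "H 1 \<le> H t" if t: "0 < t" "t < 1" for t
  proof (rule DERIV_nonpos_imp_nonincreasing[of t 1 H])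
    fix x assume "t \<le> x" "x \<le> 1"
    then have "0 < x" using t by simp
    then have "(x * F' x - F x * ln (F x)) / (x\<^sup>2 * F x) - c \<le> 0"
      using ent[of x] pos[of x] by (simp add: pos_divide_le_eq mult.assoc)
    then show "\<exists>y. (H has_real_derivative y) (at x) \<and> y \<le> 0"
      using dH[OF \<open>0 < x\<close>] by blast
  qed (use t in simp)
  then have "\<forall>\<^sub>F t in at_right 0. H 1 \<le> H t"
    by (auto simp: eventually_at_right_field intro!: exI[of _ 1])
  moreover have "(H \<longlongrightarrow> F' 0 - c * 0) (at_right 0)"
    unfolding H_def
  proof (intro tendsto_intros)
    have "((\<lambda>t. ln (F t) / t) \<longlongrightarrow> F' 0) (at 0)"
      using dlog[of 0] \<open>F 0 = 1\<close> by (simp add: DERIV_def)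
    then show "((\<lambda>t. ln (F t) / t) \<longlongrightarrow> F' 0) (at_right 0)"
      by (rule filterlim_mono[OF _ order_refl at_le]) simp
  qed
  ultimately have "H 1 \<le> F' 0 - c * 0"
    by (intro tendsto_lowerbound) auto
  then have "ln (F 1) \<le> F' 0 + c"
    by (simp add: H_def)
  then show ?thesis
    using pos[of 1] by (metis exp_le_cancel_iff exp_ln)
qed

text \<open>The Herbst argument for the moment generating function of \<open>g\<close>, where \<open>F' 0\<close> is the mean of \<open>g\<close>.\<close>

lemma (in prob_space) entropy_bound_imp_mgf_bound:
  fixes g :: "_ \<Rightarrow> real"
  assumes g: "g \<in> borel_measurable M" and V: "finite V" "\<And>x. g x \<in> V"
    and ent: "\<And>t. Ent M (\<lambda>x. exp (t * g x)) \<le> c * t\<^sup>2 * (\<integral>x. exp (t * g x) \<partial>M)"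
  shows "(\<integral>x. exp (g x) \<partial>M) \<le> exp ((\<integral>x. g x \<partial>M) + c)"
proof -
  note int = integral_comp_finite_range[OF g V]
  define F where "F = (\<lambda>t. \<integral>x. exp (t * g x) \<partial>M)"
  define F' where "F' = (\<lambda>t. \<integral>x. g x * exp (t * g x) \<partial>M)"
  have "F 1 \<le> exp (F' 0 + c)"
  proof (rule Herbst)
    show "(F has_real_derivative F' t) (at t)" for t
      unfolding F_def F'_def int(2)[of "\<lambda>v. exp (_ * v)"] int(2)[of "\<lambda>v. v * exp (t * v)"]
      by (auto intro!: derivative_eq_intros sum.cong)
    show "0 < F t" for t
    proof -
      have "0 \<le> F t" unfolding F_def by simp
      moreover have "F t \<noteq> 0"
        unfolding F_def by (subst integral_nonneg_eq_0_iff_AE) (auto simp: int(1)[of "\<lambda>v. exp (t * v)"])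
      ultimately show ?thesis by simp
    qed
    show "F 0 = 1" by (simp add: F_def prob_space)
    show "t * F' t - F t * ln (F t) \<le> c * t\<^sup>2 * F t" for t
    proof -
      have "t * F' t = (\<integral>x. exp (t * g x) * ln (exp (t * g x)) \<partial>M)"
        unfolding F'_def integral_mult_right_zero[symmetric]
        by (intro Bochner_Integration.integral_cong) auto
      then show ?thesis
        using ent[of t] by (simp add: Ent_def F_def)
    qed
  qed
  then show ?thesis by (simp add: F_def F'_def)
qed

section \<open>Integrals against conditional laws\<close>

lemma others_measurable [measurable]: "others i \<in> borel \<rightarrow>\<^sub>M others_space i"
  unfolding others_def by (intro measurable_restrict borel_measurable_nth)

text \<open>
  The tower property, for bounded functions of the form \<open>h (others i x) * indicator B (x $ i)\<close>. These
  products suffice, because an exponential of signs takes only two values along the \<open>i\<close>-th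
  coordinate. The measure of \<open>B\<close> is a version of a conditional probability, so the identity is the
  defining property of conditional expectation, tested against \<open>h\<close>.
\<close>

lemma cond_law_integral:
  fixes \<nu> :: "(real ^ 'n) measure" and h :: "('n \<Rightarrow> real) \<Rightarrow> real"
  assumes \<nu>: "prob_space \<nu>" "sets \<nu> = sets borel" and K: "cond_law \<nu> i K"
    and h [measurable]: "h \<in> borel_measurable (others_space i)" and B: "B \<in> sets borel"
    and bounded: "\<And>y. \<bar>h y\<bar> \<le> C"
  shows "(\<integral>x. h (others i x) * measure (K (others i x)) B \<partial>\<nu>)
    = (\<integral>x. h (others i x) * indicator B (x $ i) \<partial>\<nu>)"
proof -
  interpret prob_space \<nu> by fact
  let ?G = "vimage_algebra (space \<nu>) (others i) (others_space i)"
  note [measurable_cong] = \<nu>(2)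
  have oth: "others i \<in> \<nu> \<rightarrow>\<^sub>M others_space i" by measurable
  have sub: "subalgebra \<nu> ?G"
    using oth by (auto simp: subalgebra_def measurable_iff_sets)
  interpret finite_measure_subalgebra \<nu> ?G
    by unfold_locales (rule sub)
  have [measurable]: "(\<lambda>x. indicator B (x $ i) :: real) \<in> borel_measurable \<nu>"
    using B measurable_compose[OF borel_measurable_nth borel_measurable_indicator]
    by (simp add: measurable_cong_sets[OF \<nu>(2) refl])
  have hG: "(\<lambda>x. h (others i x)) \<in> borel_measurable ?G"
    by (rule measurable_compose[OF measurable_vimage_algebra1 h])
      (use measurable_space[OF oth] in auto)
  have [measurable]: "(\<lambda>x. h (others i x)) \<in> borel_measurable \<nu>"
    using oth by measurable
  have Kcond: "AE x in \<nu>. measure (K (others i x)) B = real_cond_exp \<nu> ?G (\<lambda>x. indicator B (x $ i)) x"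
    using K B by (simp add: cond_law_def)
  have [measurable]: "(\<lambda>x. measure (K (others i x)) B) \<in> borel_measurable \<nu>"
    using K B by (auto simp: cond_law_def
        intro!: measurable_compose[OF oth] measurable_compose[OF _ measurable_measure_prob_algebra])
  have "integrable \<nu> (\<lambda>x. h (others i x) * indicator B (x $ i))"
  proof (rule integrable_const_bound[of _ C])
    show "AE x in \<nu>. norm (h (others i x) * indicator B (x $ i)) \<le> C"
      using bounded order_trans[OF abs_ge_zero bounded] by (auto simp: indicator_def)
  qed measurable
  note this = real_cond_exp_intg(2)[OF this hG]
  then have "(\<integral>x. h (others i x) * indicator B (x $ i) \<partial>\<nu>)
      = (\<integral>x. h (others i x) * real_cond_exp \<nu> ?G (\<lambda>x. indicator B (x $ i)) x \<partial>\<nu>)"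
    by simp
  also have "\<dots> = (\<integral>x. h (others i x) * measure (K (others i x)) B \<partial>\<nu>)"
    using Kcond by (intro integral_cong_AE) auto
  finally show ?thesis ..
qed

section \<open>The entropy inequality for exponentials of signs\<close>

definition sgn_at :: "real \<Rightarrow> real \<Rightarrow> real" where
  "sgn_at s t = (if t = 0 then s else sgn t)"

lemma sgn_at_measurable [measurable]: "sgn_at s \<in> borel_measurable borel"
  unfolding sgn_at_def by measurable

lemma sgn_at_cases: "s \<in> {-1, 1} \<Longrightarrow> sgn_at s t \<in> {-1, 1}"
  by (auto simp: sgn_at_def sgn_if)

lemma inner_sign_vec: "u \<bullet> sign_vec s x = (\<Sum>i\<in>UNIV. u $ i * sgn_at s (x $ i))"
  by (simp add: inner_vec_def sign_vec_def sgn_at_def)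

lemma sign_vec_measurable [measurable]:
  "(sign_vec s :: real ^ 'n \<Rightarrow> real ^ 'n) \<in> borel_measurable borel"
proof (subst borel_measurable_euclidean_space, intro ballI)
  fix b :: "real ^ 'n" assume "b \<in> Basis"
  have "(\<lambda>x :: real ^ 'n. \<Sum>i\<in>UNIV. b $ i * sgn_at s (x $ i)) \<in> borel_measurable borel"
    by (intro borel_measurable_sum borel_measurable_times
        measurable_compose[OF borel_measurable_nth sgn_at_measurable]) simp
  then show "(\<lambda>x :: real ^ 'n. sign_vec s x \<bullet> b) \<in> borel_measurable borel"
    by (simp add: inner_commute[of _ b] inner_sign_vec)
qed

text \<open>
  The entropy of the slice depends on the other coordinates only through the constant factor \<open>h\<close> and
  through \<open>q\<close>, the conditional probability of a positive \<open>i\<close>-th sign. It is a bounded measurable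
  function of these, hence integrable. The two-point inequality bounds it by \<open>(u $ i)\<^sup>2 / 2\<close> times the
  mean \<open>h * m\<close> of the slice, which is affine in \<open>q\<close>, so that the tower property applies.
\<close>

lemma conditional_entropy_exp_sign:
  fixes \<nu> :: "(real ^ 'n) measure" and u :: "real ^ 'n"
  assumes \<nu>: "prob_space \<nu>" "sets \<nu> = sets borel" and K: "cond_law \<nu> i K"
    and s: "s \<in> {-1, 1}"
  defines "f \<equiv> \<lambda>x. exp (u \<bullet> sign_vec s x)"
  shows "Ent_defined (K (others i x)) (slice f i (others i x))"
    and "integrable \<nu> (\<lambda>x. Ent (K (others i x)) (slice f i (others i x)))"
    and "(\<integral>x. Ent (K (others i x)) (slice f i (others i x)) \<partial>\<nu>) \<le> (u $ i)\<^sup>2 / 2 * (\<integral>x. f x \<partial>\<nu>)"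
proof -
  interpret prob_space \<nu> by fact
  note [measurable_cong] = \<nu>(2)
  define a where "a = u $ i"
  define B where "B = {t. sgn_at s t = 1}"
  define h where "h = (\<lambda>y. exp (\<Sum>j\<in>- {i}. u $ j * sgn_at s (y j)))"
  define q where "q = (\<lambda>x. measure (K (others i x)) B)"
  define m where "m = (\<lambda>x. q x * exp a + (1 - q x) * exp (-a))"
  define G where "G = (\<lambda>x. a * (q x * exp a - (1 - q x) * exp (-a)) - m x * ln (m x))"
  define C where "C = exp (\<Sum>j\<in>- {i}. \<bar>u $ j\<bar>)"

  have split: "slice f i y t = h y * exp (a * sgn_at s t)" for y t
  proof -
    have "u \<bullet> sign_vec s (vec_lambda (y(i := t)))
        = (\<Sum>j\<in>UNIV. u $ j * sgn_at s ((y(i := t)) j))"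
      by (simp add: inner_sign_vec)
    also have "\<dots> = a * sgn_at s t + (\<Sum>j\<in>UNIV - {i}. u $ j * sgn_at s ((y(i := t)) j))"
      by (subst sum.remove[of _ i]) (auto simp: a_def)
    also have "(\<Sum>j\<in>UNIV - {i}. u $ j * sgn_at s ((y(i := t)) j)) = (\<Sum>j\<in>- {i}. u $ j * sgn_at s (y j))"
      by (intro sum.cong) auto
    finally have "u \<bullet> sign_vec s (vec_lambda (y(i := t)))
        = a * sgn_at s t + (\<Sum>j\<in>- {i}. u $ j * sgn_at s (y j))" .
    then show ?thesis
      by (simp only: slice_def f_def h_def exp_add mult.commute)
  qed
  have f_split: "f x = h (others i x) * exp (a * sgn_at s (x $ i))" for x
  proof -
    have "vec_lambda ((others i x)(i := x $ i)) = x"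
      by (auto simp: vec_eq_iff others_def)
    then show ?thesis
      using split[of "others i x" "x $ i"] by (simp add: slice_def)
  qed

  have oth: "others i \<in> \<nu> \<rightarrow>\<^sub>M others_space i" by measurable
  have Kx: "prob_space (K (others i x))" "sets (K (others i x)) = sets borel" for x
  proof -
    have "others i x \<in> space (others_space i)"
      using measurable_space[OF others_measurable] by auto
    then have "K (others i x) \<in> space (prob_algebra borel)"
      using K by (auto simp: cond_law_def dest: measurable_space)
    then show "prob_space (K (others i x))" "sets (K (others i x)) = sets borel"
      by (auto simp: space_prob_algebra)
  qed
  have B: "B \<in> sets borel"
    using measurable_sets[OF sgn_at_measurable, of "{1}" s] by (simp add: B_def vimage_def)
  have q: "0 \<le> q x" "q x \<le> 1" for x
    using prob_space.prob_le_1[OF Kx(1)] by (auto simp: q_def)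
  have q_meas [measurable]: "q \<in> borel_measurable \<nu>"
    using K B unfolding q_def by (auto simp: cond_law_def
        intro!: measurable_compose[OF oth] measurable_compose[OF _ measurable_measure_prob_algebra])
  have h [measurable]: "h \<in> borel_measurable (others_space i)"
    unfolding h_def by measurable
  have h_oth [measurable]: "(\<lambda>x. h (others i x)) \<in> borel_measurable \<nu>"
    using oth by measurable
  have h_pos: "0 < h y" for y
    by (simp add: h_def)
  have abs_sgn: "\<bar>sgn_at s t\<bar> = 1" for t
    using sgn_at_cases[OF s, of t] by auto
  have h_le: "\<bar>h y\<bar> \<le> C" for y
  proof -
    have "(\<Sum>j\<in>- {i}. u $ j * sgn_at s (y j)) \<le> (\<Sum>j\<in>- {i}. \<bar>u $ j\<bar>)"
    proof (rule sum_mono)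
      fix j
      have "u $ j * sgn_at s (y j) \<le> \<bar>u $ j * sgn_at s (y j)\<bar>" by simp
      then show "u $ j * sgn_at s (y j) \<le> \<bar>u $ j\<bar>" by (simp add: abs_mult abs_sgn)
    qed
    then show ?thesis by (simp add: h_def C_def)
  qed
  have m_bounds: "0 < m x" "m x \<le> exp \<bar>a\<bar>" "exp (- \<bar>a\<bar>) \<le> m x" for x
    unfolding m_def using two_point_exp_pos two_point_exp_le two_point_exp_ge q by auto

  have ent: "Ent_defined (K (others i x)) (slice f i (others i x))"
    "Ent (K (others i x)) (slice f i (others i x)) = h (others i x) * G x" for x
  proof -
    interpret Kx: prob_space "K (others i x)" by (rule Kx)
    have "slice f i (others i x) = (\<lambda>t. h (others i x) * exp (a * sgn_at s t))"
      by (simp add: split fun_eq_iff)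
    moreover have "sgn_at s \<in> borel_measurable (K (others i x))"
      by (simp add: measurable_cong_sets[OF Kx(2) refl])
    moreover have "{t \<in> space (K (others i x)). sgn_at s t = 1} = B"
      using sets_eq_imp_space_eq[OF Kx(2)] by (simp add: B_def)
    ultimately show "Ent_defined (K (others i x)) (slice f i (others i x))"
      "Ent (K (others i x)) (slice f i (others i x)) = h (others i x) * G x"
      using Kx.Ent_exp_pm_one[of "sgn_at s" "h (others i x)" a] sgn_at_cases[OF s] h_pos
      by (simp_all add: G_def m_def q_def)
  qed
  show "Ent_defined (K (others i x)) (slice f i (others i x))"
    by (rule ent)

  have G_abs: "\<bar>G x\<bar> \<le> 2 * \<bar>a\<bar> * exp \<bar>a\<bar>" for x
  proof -
    have "\<bar>q x * exp a - (1 - q x) * exp (-a)\<bar> \<le> m x"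
      unfolding m_def using q[of x] by (intro abs_leI) simp_all
    then have 1: "\<bar>a * (q x * exp a - (1 - q x) * exp (-a))\<bar> \<le> \<bar>a\<bar> * exp \<bar>a\<bar>"
      unfolding abs_mult using m_bounds(2)[of x] by (intro mult_left_mono) auto
    have "ln (m x) \<le> \<bar>a\<bar>" "- \<bar>a\<bar> \<le> ln (m x)"
      using m_bounds[of x] ln_le_cancel_iff[of "m x" "exp \<bar>a\<bar>"] by (simp_all add: ln_ge_iff)
    then have "\<bar>ln (m x)\<bar> \<le> \<bar>a\<bar>" by simp
    then have "\<bar>ln (m x)\<bar> * \<bar>m x\<bar> \<le> \<bar>a\<bar> * exp \<bar>a\<bar>"
      using m_bounds[of x] by (intro mult_mono) auto
    then have 2: "\<bar>m x * ln (m x)\<bar> \<le> \<bar>a\<bar> * exp \<bar>a\<bar>"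
      by (simp add: abs_mult mult.commute)
    show ?thesis
      unfolding G_def using order_trans[OF abs_triangle_ineq4 add_mono[OF 1 2]] by simp
  qed
  have G_meas [measurable]: "G \<in> borel_measurable \<nu>"
    unfolding G_def m_def by measurable
  have int_ent: "integrable \<nu> (\<lambda>x. h (others i x) * G x)"
  proof (rule integrable_const_bound[of _ "C * (2 * \<bar>a\<bar> * exp \<bar>a\<bar>)"])
    show "AE x in \<nu>. norm (h (others i x) * G x) \<le> C * (2 * \<bar>a\<bar> * exp \<bar>a\<bar>)"
      unfolding real_norm_def abs_mult by (intro AE_I2 mult_mono h_le G_abs) (simp_all add: C_def)
  qed measurable
  then show "integrable \<nu> (\<lambda>x. Ent (K (others i x)) (slice f i (others i x)))"
    by (simp add: ent(2))

  have int_h: "integrable \<nu> (\<lambda>x. h (others i x))"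
    by (rule integrable_const_bound[of _ C]) (simp_all add: h_le)
  have int_hq: "integrable \<nu> (\<lambda>x. h (others i x) * q x)"
  proof (rule integrable_const_bound[of _ "C * 1"])
    show "AE x in \<nu>. norm (h (others i x) * q x) \<le> C * 1"
      unfolding real_norm_def abs_mult using q by (intro AE_I2 mult_mono h_le) (simp_all add: C_def)
  qed measurable
  have ind_meas: "(\<lambda>x. indicator B (x $ i) :: real) \<in> borel_measurable \<nu>"
    using B measurable_compose[OF borel_measurable_nth borel_measurable_indicator]
    by (simp add: measurable_cong_sets[OF \<nu>(2) refl])
  have int_hB: "integrable \<nu> (\<lambda>x. h (others i x) * indicator B (x $ i))"
  proof (rule integrable_const_bound[of _ "C * 1"])
    show "AE x in \<nu>. norm (h (others i x) * indicator B (x $ i)) \<le> C * 1"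
      unfolding real_norm_def abs_mult by (intro AE_I2 mult_mono h_le) (simp_all add: C_def indicator_def)
  qed (use ind_meas in measurable)

  \<comment> \<open>The mean of the slice and \<open>f\<close> itself are the same affine expression, in \<open>q\<close> and in the indicator.\<close>
  have hm: "h (others i x) * m x = exp (-a) * h (others i x) + (exp a - exp (-a)) * (h (others i x) * q x)" for x
    by (simp add: m_def algebra_simps)
  have fB: "f x = exp (-a) * h (others i x) + (exp a - exp (-a)) * (h (others i x) * indicator B (x $ i))" for x
    unfolding f_split using sgn_at_cases[OF s, of "x $ i"]
    by (auto simp: B_def indicator_def algebra_simps)
  have "(\<integral>x. h (others i x) * G x \<partial>\<nu>) \<le> (\<integral>x. a\<^sup>2 / 2 * (h (others i x) * m x) \<partial>\<nu>)"
  proof (rule integral_mono[OF int_ent])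
    show "integrable \<nu> (\<lambda>x. a\<^sup>2 / 2 * (h (others i x) * m x))"
      unfolding hm using int_h int_hq by (intro integrable_mult_right Bochner_Integration.integrable_add)
    fix x
    have "G x \<le> a\<^sup>2 / 2 * m x"
      unfolding G_def m_def by (rule two_point_log_Sobolev[OF q])
    then have "h (others i x) * G x \<le> h (others i x) * (a\<^sup>2 / 2 * m x)"
      using h_pos by (intro mult_left_mono) (auto intro: less_imp_le)
    then show "h (others i x) * G x \<le> a\<^sup>2 / 2 * (h (others i x) * m x)"
      by (simp add: mult_ac)
  qed
  also have "\<dots> = a\<^sup>2 / 2 * (\<integral>x. h (others i x) * m x \<partial>\<nu>)"
    by simp
  also have "(\<integral>x. h (others i x) * m x \<partial>\<nu>) =
      exp (-a) * (\<integral>x. h (others i x) \<partial>\<nu>) + (exp a - exp (-a)) * (\<integral>x. h (others i x) * q x \<partial>\<nu>)"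
    unfolding hm using int_h int_hq by (subst Bochner_Integration.integral_add) auto
  also have "(\<integral>x. h (others i x) * q x \<partial>\<nu>) = (\<integral>x. h (others i x) * indicator B (x $ i) \<partial>\<nu>)"
    unfolding q_def by (rule cond_law_integral[OF \<nu> K h B h_le])
  also have "exp (-a) * (\<integral>x. h (others i x) \<partial>\<nu>) + (exp a - exp (-a)) * \<dots> = (\<integral>x. f x \<partial>\<nu>)"
    unfolding fB using int_h int_hB by (subst Bochner_Integration.integral_add) auto
  finally show "(\<integral>x. Ent (K (others i x)) (slice f i (others i x)) \<partial>\<nu>) \<le> (u $ i)\<^sup>2 / 2 * (\<integral>x. f x \<partial>\<nu>)"
    by (simp add: ent(2) a_def)
qed

lemma finite_range_inner_sign_vec:
  fixes u :: "real ^ 'n"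
  assumes "s \<in> {-1, 1}"
  shows "finite (range (\<lambda>x :: real ^ 'n. u \<bullet> sign_vec s x))"
proof -
  have "range (\<lambda>x :: real ^ 'n. u \<bullet> sign_vec s x) \<subseteq> (\<lambda>v. \<Sum>i\<in>UNIV. u $ i * v i) ` (UNIV \<rightarrow>\<^sub>E {-1, 1})"
  proof safe
    fix x :: "real ^ 'n"
    have "(\<lambda>i. sgn_at s (x $ i)) \<in> UNIV \<rightarrow>\<^sub>E {-1, 1}"
      using sgn_at_cases[OF assms] by (auto simp: PiE_def)
    then show "u \<bullet> sign_vec s x \<in> (\<lambda>v. \<Sum>i\<in>UNIV. u $ i * v i) ` (UNIV \<rightarrow>\<^sub>E {-1, 1})"
      unfolding inner_sign_vec by (rule rev_image_eqI) simp
  qed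
  then show ?thesis
    by (rule finite_subset) (intro finite_imageI finite_PiE; simp)
qed

lemma ATE_entropy_exp_sign:
  fixes \<nu> :: "(real ^ 'n) measure" and u :: "real ^ 'n"
  assumes \<nu>: "prob_space \<nu>" "sets \<nu> = sets borel" and "ATE \<nu> \<kappa>" and "0 \<le> \<kappa>"
    and s: "s \<in> {-1, 1}"
  shows "Ent \<nu> (\<lambda>x. exp (u \<bullet> sign_vec s x)) \<le> \<kappa> * (norm u)\<^sup>2 / 2 * (\<integral>x. exp (u \<bullet> sign_vec s x) \<partial>\<nu>)"
proof -
  interpret prob_space \<nu> by fact
  note [measurable_cong] = \<nu>(2)
  let ?f = "\<lambda>x. exp (u \<bullet> sign_vec s x)"
  obtain K where K: "\<And>i. cond_law \<nu> i (K i)"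
    and ate: "\<And>f. \<lbrakk>f \<in> borel_measurable borel; Ent_defined \<nu> f;
      \<forall>i. AE x in \<nu>. Ent_defined (K i (others i x)) (slice f i (others i x));
      \<forall>i. integrable \<nu> (\<lambda>x. Ent (K i (others i x)) (slice f i (others i x)))\<rbrakk> \<Longrightarrow>
      Ent \<nu> f \<le> \<kappa> * (\<Sum>i\<in>UNIV. \<integral>x. Ent (K i (others i x)) (slice f i (others i x)) \<partial>\<nu>)"
    using \<open>ATE \<nu> \<kappa>\<close> unfolding ATE_def by blast
  note cond = conditional_entropy_exp_sign[OF \<nu> K s, where u = u]
  have meas: "(\<lambda>x. u \<bullet> sign_vec s x) \<in> borel_measurable \<nu>"
    by measurable
  note int = integral_comp_finite_range(1)[OF meas finite_range_inner_sign_vec[OF s] rangeI]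
  have "Ent \<nu> ?f \<le> \<kappa> * (\<Sum>i\<in>UNIV. \<integral>x. Ent (K i (others i x)) (slice ?f i (others i x)) \<partial>\<nu>)"
  proof (rule ate)
    show "?f \<in> borel_measurable borel" by measurable
    show "Ent_defined \<nu> ?f"
      unfolding Ent_defined_def using int[of exp] int[of "\<lambda>t. exp t * \<bar>ln (exp t)\<bar>"] by simp
  qed (use cond in auto)
  also have "\<dots> \<le> \<kappa> * (\<Sum>i\<in>UNIV. (u $ i)\<^sup>2 / 2 * (\<integral>x. ?f x \<partial>\<nu>))"
    using \<open>0 \<le> \<kappa>\<close> by (intro mult_left_mono sum_mono cond)
  also have "\<dots> = \<kappa> * (norm u)\<^sup>2 / 2 * (\<integral>x. ?f x \<partial>\<nu>)"
    by (simp add: norm_vec_def L2_set_def sum_nonneg flip: sum_distrib_right sum_divide_distrib)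
  finally show ?thesis .
qed

theorem corollary4p2:
  fixes \<nu> :: "(real ^ 'n) measure" and \<kappa> s :: real
    and M :: "'a measure" and X :: "'a \<Rightarrow> real ^ 'n"
  assumes "prob_space \<nu>" and "sets \<nu> = sets borel"
    and "1 \<le> \<kappa>" and "ATE \<nu> \<kappa>"
    and "prob_space M" and "X \<in> borel_measurable M" and "distr M borel X = \<nu>"
    and "s \<in> {-1, 1}"
  shows "sub_Gaussian M \<kappa> (\<lambda>\<omega>. sign_vec s (X \<omega>))"
proof -
  interpret M: prob_space M by fact
  interpret \<nu>: prob_space \<nu> by fact
  note [measurable] = \<open>X \<in> borel_measurable M\<close>
  have Y: "(\<lambda>\<omega>. sign_vec s (X \<omega>)) \<in> borel_measurable M" by measurable
  show ?thesis
    unfolding sub_Gaussian_def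
  proof (intro conjI allI Y)
    fix u :: "real ^ 'n"
    let ?g = "\<lambda>x. u \<bullet> sign_vec s x"
    let ?\<mu> = "\<integral>\<omega>. ?g (X \<omega>) \<partial>M"
    have Z: "(\<lambda>\<omega>. ?g (X \<omega>)) \<in> borel_measurable M" by measurable
    have range: "finite (range ?g)"
      by (rule finite_range_inner_sign_vec) fact
    note int = M.integral_comp_finite_range(1)[OF Z range rangeI]
    show "integrable M (\<lambda>\<omega>. ?g (X \<omega>))"
      using int[of "\<lambda>t. t"] .
    show "integrable M (\<lambda>\<omega>. exp (?g (X \<omega>) - ?\<mu>))"
      using int[of "\<lambda>t. exp (t - ?\<mu>)"] .
    have transfer: "(\<integral>x. \<psi> (?g x) \<partial>\<nu>) = (\<integral>\<omega>. \<psi> (?g (X \<omega>)) \<partial>M)"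
      if [measurable]: "\<psi> \<in> borel_measurable borel" for \<psi> :: "real \<Rightarrow> real"
      unfolding \<open>distr M borel X = \<nu>\<close>[symmetric] by (rule integral_distr) measurable
    have "(\<integral>x. exp (?g x) \<partial>\<nu>) \<le> exp ((\<integral>x. ?g x \<partial>\<nu>) + \<kappa> * (norm u)\<^sup>2 / 2)"
    proof (rule \<nu>.entropy_bound_imp_mgf_bound[OF _ range rangeI])
      show "?g \<in> borel_measurable \<nu>"
        by (simp add: measurable_cong_sets[OF \<open>sets \<nu> = sets borel\<close> refl])
      show "Ent \<nu> (\<lambda>x. exp (t * ?g x)) \<le> \<kappa> * (norm u)\<^sup>2 / 2 * t\<^sup>2 * (\<integral>x. exp (t * ?g x) \<partial>\<nu>)" for t
        using ATE_entropy_exp_sign[of \<nu> \<kappa> s "t *\<^sub>R u"] assms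
        by (simp add: power_mult_distrib mult_ac)
    qed
    then have "(\<integral>\<omega>. exp (?g (X \<omega>)) \<partial>M) \<le> exp (?\<mu> + \<kappa> * (norm u)\<^sup>2 / 2)"
      using transfer[of exp] transfer[of "\<lambda>t. t"] by simp
    then show "(\<integral>\<omega>. exp (?g (X \<omega>) - ?\<mu>) \<partial>M) \<le> exp (\<kappa> * (norm u)\<^sup>2 / 2)"
      by (simp add: exp_diff exp_add pos_divide_le_eq mult.commute)
  qed
qed

end
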